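(* If $a\geq 2$ and $q>4a^2\log a$ are integers, then \[ \chi_{sc}(K_{a,q})\geq 2q+0.06\,a\sqrt{q\log a}. \]
   Context: $K_{a,q}$ is the complete bipartite graph with parts of sizes $a$ and $q$. For a graph $G=(V,E)$ and $f:V\to\mathbb{N}$, an $f$-assignment is an assignment of color lists $L(v)$ with $|L(v)|=f(v)$; $G$ is $f$-choosable if for every $f$-assignment $L$ there is a proper coloring $c$ with $c(v)\in L(v)$ for all $v$. The sum choice number $\chi_{sc}(G)$ is the minimum of $\sum_{v\in V}f(v)$ over all $f$ such that $G$ is $f$-choosable. $\log$ denotes the natural logarithm. *)

theory Defs
  imports Complex_Main
begin

text \<open>A graph is a pair of a vertex set and a set of edges, each edge being a two-element set
  of vertices.\<close>

type_synonym 'v graph = "'v set \<times> 'v set set"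

definition complete_bipartite :: "nat \<Rightarrow> nat \<Rightarrow> (nat + nat) graph" where
  "complete_bipartite a q =
     ({..<a} <+> {..<q}, {{Inl i, Inr j} | i j. i < a \<and> j < q})"

text \<open>Colours are natural numbers, which suffices since lists are finite. Finiteness is demanded
  explicitly because the cardinality of an infinite set is 0 by convention.\<close>

definition list_assignment :: "'v graph \<Rightarrow> ('v \<Rightarrow> nat) \<Rightarrow> ('v \<Rightarrow> nat set) \<Rightarrow> bool" where
  "list_assignment G f L \<longleftrightarrow> (\<forall>v \<in> fst G. finite (L v) \<and> card (L v) = f v)"

definition proper_coloring :: "'v graph \<Rightarrow> ('v \<Rightarrow> nat) \<Rightarrow> bool" where
  "proper_coloring G c \<longleftrightarrow> (\<forall>u \<in> fst G. \<forall>v \<in> fst G. {u, v} \<in> snd G \<longrightarrow> c u \<noteq> c v)"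

definition choosable :: "'v graph \<Rightarrow> ('v \<Rightarrow> nat) \<Rightarrow> bool" where
  "choosable G f \<longleftrightarrow>
     (\<forall>L. list_assignment G f L \<longrightarrow> (\<exists>c. proper_coloring G c \<and> (\<forall>v \<in> fst G. c v \<in> L v)))"

definition sum_choice_number :: "'v graph \<Rightarrow> nat" where
  "sum_choice_number G = (LEAST n. \<exists>f. choosable G f \<and> n = (\<Sum>v \<in> fst G. f v))"

text \<open>The minimum is attained for every finite loopless graph, so the LEAST above is
  meaningful for \<open>complete_bipartite a q\<close>.\<close>

lemma choosable_card:
  assumes "finite (fst G)" and "\<And>v. {v} \<notin> snd G"
  shows "choosable G (\<lambda>v. card (fst G))"
  unfolding choosable_def
proof (intro allI impI)
  fix L assume L: "list_assignment G (\<lambda>v. card (fst G)) L"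
  have "\<exists>c. inj_on c S \<and> (\<forall>v \<in> S. c v \<in> L v)" if "finite S" "S \<subseteq> fst G" for S
    using that
  proof (induction S rule: finite_induct)
    case empty
    show ?case by simp
  next
    case (insert x S)
    then obtain c where c: "inj_on c S" "\<forall>v \<in> S. c v \<in> L v" by auto
    have "card (c ` S) \<le> card S" using insert by (simp add: card_image_le)
    also have "\<dots> < card (insert x S)" using insert by simp
    also have "\<dots> \<le> card (fst G)" using insert assms by (intro card_mono) auto
    also have "\<dots> = card (L x)" using L insert by (auto simp: list_assignment_def)
    finally have "\<not> L x \<subseteq> c ` S"
      using insert by (metis card_mono finite_imageI linorder_not_le)
    then obtain y where y: "y \<in> L x" "y \<notin> c ` S" by auto
    have "inj_on (c(x := y)) (insert x S)"
      using c y insert by (auto simp: inj_on_def)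
    moreover have "\<forall>v \<in> insert x S. (c(x := y)) v \<in> L v" using c y by auto
    ultimately show ?case by blast
  qed
  from this[OF assms(1) subset_refl] obtain c
    where c: "inj_on c (fst G)" "\<forall>v \<in> fst G. c v \<in> L v" by auto
  have "proper_coloring G c"
    unfolding proper_coloring_def
    using c(1) assms(2) by (metis inj_on_contraD insert_absorb2)
  with c show "\<exists>c. proper_coloring G c \<and> (\<forall>v \<in> fst G. c v \<in> L v)" by blast
qed

lemma sum_choice_number_attained:
  assumes "finite (fst G)" and "\<And>v. {v} \<notin> snd G"
  shows "\<exists>f. choosable G f \<and> sum_choice_number G = (\<Sum>v \<in> fst G. f v)"
  unfolding sum_choice_number_def
  by (rule LeastI_ex) (use choosable_card[OF assms] in blast)

lemma complete_bipartite_finite_loopless: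
  "finite (fst (complete_bipartite a q))" "{v} \<notin> snd (complete_bipartite a q)"
  by (auto simp: complete_bipartite_def dest!: equalityD2)

end

theory Submission
  imports Defs "HOL-Library.Nat_Bijection"
begin

text \<open>Suppose \<open>f\<close> is choosable on \<open>K\<^bsub>a,q\<^esub>\<close> with sum below \<open>2 q + T\<close>. Vertices with \<open>f = 1\<close> on the
  \<open>q\<close>-side are fewer than any list on the \<open>a\<close>-side, so they save at most one such list; hence
  about half of the \<open>a\<close>-side has lists of size at most \<open>2 T / a\<close>, and all but \<open>T\<close> vertices of the
  \<open>q\<close>-side have lists of size at most 2.

  Take \<open>t \<approx> log\<^sub>2 a\<close> copies of \<open>K\<^bsub>s,s\<^esub>\<close> on disjoint sets of colours and use the \<open>t s\<^sup>2\<close> edges as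
  lists on the \<open>q\<close>-side. The colours used on the \<open>a\<close>-side then form an independent set, which
  misses one half of every copy. The \<open>2\<^sup>t\<close> unions of one half from each copy, used as
  lists on the \<open>a\<close>-side, therefore cannot all be hit. Each has \<open>t s\<close> colours, and
  \<open>t s\<^sup>2 \<approx> q\<close> allows \<open>t s \<approx> sqrt (t q)\<close>, which exceeds \<open>2 T / a\<close>.\<close>

lemma choosable_complete_bipartiteD:
  fixes L :: "nat + nat \<Rightarrow> nat set"
  assumes "choosable (complete_bipartite a q) f"
    and "\<And>i. i < a \<Longrightarrow> finite (L (Inl i)) \<and> card (L (Inl i)) = f (Inl i)"
    and "\<And>j. j < q \<Longrightarrow> finite (L (Inr j)) \<and> card (L (Inr j)) = f (Inr j)"
  obtains c where "\<And>i. i < a \<Longrightarrow> c (Inl i) \<in> L (Inl i)" "\<And>j. j < q \<Longrightarrow> c (Inr j) \<in> L (Inr j)"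
    "\<And>i j. i < a \<Longrightarrow> j < q \<Longrightarrow> c (Inl i) \<noteq> c (Inr j)"
proof -
  have "list_assignment (complete_bipartite a q) f L"
    using assms(2,3) by (auto simp: list_assignment_def complete_bipartite_def)
  then obtain c where c: "proper_coloring (complete_bipartite a q) c"
      "\<forall>v \<in> fst (complete_bipartite a q). c v \<in> L v"
    using assms(1) unfolding choosable_def by blast
  have "c (Inl i) \<noteq> c (Inr j)" if "i < a" "j < q" for i j
  proof -
    have "Inl i \<in> fst (complete_bipartite a q)" "Inr j \<in> fst (complete_bipartite a q)"
      "{Inl i, Inr j} \<in> snd (complete_bipartite a q)"
      using that by (auto simp: complete_bipartite_def)
    then show ?thesis using c(1) unfolding proper_coloring_def by blast
  qed
  then show thesis
    using c(2) by (intro that[of c]) (auto simp: complete_bipartite_def)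
qed

lemma choosable_complete_bipartite_pos:
  assumes "choosable (complete_bipartite a q) f" and "j < q"
  shows "f (Inr j) \<ge> 1"
proof -
  obtain c :: "nat + nat \<Rightarrow> nat" where "\<And>j. j < q \<Longrightarrow> c (Inr j) \<in> {..<f (Inr j)}"
    by (rule choosable_complete_bipartiteD[OF assms(1), of "\<lambda>v. {..<f v}"])
      (simp, simp, blast)
  from this[OF assms(2)] show ?thesis by simp
qed

text \<open>Used to label the vertices in \<open>A\<close> so that every wanted colour or edge in
  \<open>B\<close> occurs as a label; labels may repeat, and some may lie outside
  \<open>B\<close>.\<close>

lemma obtain_surj_on:
  assumes "finite A" "finite B" "card B \<le> card A"
  obtains g where "B \<subseteq> g ` A"
proof -
  obtain h where h: "inj_on h B" "h ` B \<subseteq> A"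
    using card_le_inj[OF assms(2,1,3)] by blast
  have "B \<subseteq> inv_into B h ` A"
    using h by (metis image_mono inv_into_image_cancel subset_refl)
  then show thesis by (rule that)
qed

text \<open>Otherwise there are enough one-colour lists on the \<open>q\<close>-side to forbid each
  colour in the list of \<open>i\<close>.\<close>

lemma choosable_complete_bipartite_singletons_less:
  assumes f: "choosable (complete_bipartite a q) f" and "i < a"
  shows "card {j. j < q \<and> f (Inr j) = 1} < f (Inl i)"
proof (rule ccontr)
  assume "\<not> ?thesis"
  then have "card {..<f (Inl i)} \<le> card {j. j < q \<and> f (Inr j) = 1}" by simp
  then obtain g where g: "{..<f (Inl i)} \<subseteq> g ` {j. j < q \<and> f (Inr j) = 1}"
    by (rule obtain_surj_on[rotated 2]) auto
  define L where
    "L v = (case v of Inl k \<Rightarrow> {..<f v} | Inr j \<Rightarrow> if f v = 1 then {g j} else {..<f v})" for v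
  obtain c where c: "\<And>i. i < a \<Longrightarrow> c (Inl i) \<in> L (Inl i)" "\<And>j. j < q \<Longrightarrow> c (Inr j) \<in> L (Inr j)"
    "\<And>i j. i < a \<Longrightarrow> j < q \<Longrightarrow> c (Inl i) \<noteq> c (Inr j)"
    by (rule choosable_complete_bipartiteD[OF f, of L]) (auto simp: L_def)
  have "c (Inl i) \<in> {..<f (Inl i)}" using c(1)[OF \<open>i < a\<close>] by (simp add: L_def)
  then obtain j where j: "j < q" "f (Inr j) = 1" "c (Inl i) = g j" using g by auto
  then have "c (Inr j) = g j" using c(2)[of j] by (simp add: L_def)
  then show False using c(3)[OF \<open>i < a\<close> j(1)] j(3) by simp
qed

text \<open>Only upper bounds on \<open>f\<close> are needed: passing to subsets of the halves'
  unions and of the edges only restricts the colouring further.\<close>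

lemma not_choosable_complete_bipartite_cube:
  assumes W: "W \<subseteq> {..<a}" "card W = 2 ^ t" "\<And>i. i \<in> W \<Longrightarrow> f (Inl i) \<le> t * s"
    and J: "t * s\<^sup>2 \<le> card {j. j < q \<and> f (Inr j) \<le> 2}"
  shows "\<not> choosable (complete_bipartite a q) f"
proof
  assume f: "choosable (complete_bipartite a q) f"
  define J where "J = {j. j < q \<and> f (Inr j) \<le> 2}"
  \<comment> \<open>\<open>e l b x\<close> is colour number \<open>x\<close> in half
    \<open>b\<close> of copy \<open>l\<close>, coded injectively because colours are natural
    numbers.\<close>
  define e :: "nat \<Rightarrow> bool \<Rightarrow> nat \<Rightarrow> nat"
    where "e l b x = prod_encode (l, prod_encode (of_bool b, x))" for l b x
  have e_inj: "e l b x = e l' b' x' \<longleftrightarrow> l = l' \<and> b = b' \<and> x = x'" for l b x l' b' x'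
    by (auto simp: e_def prod_encode_eq)
  have "finite W" using W(1) finite_subset by blast
  \<comment> \<open>A choice of one half per copy is a subset \<open>P\<close> of
    \<open>{..<t}\<close>: the \<open>True\<close> half is taken exactly in the copies
    \<open>l \<in> P\<close>. The map \<open>\<pi>\<close> gives each choice to one vertex of
    \<open>W\<close>.\<close>
  then obtain \<pi> where \<pi>: "bij_betw \<pi> W (Pow {..<t})"
    using finite_same_card_bij[of W "Pow {..<t}"] W(2) by (auto simp: card_Pow)
  have "card ({..<t} \<times> {..<s} \<times> {..<s}) \<le> card J"
    using J by (simp add: card_cartesian_product power2_eq_square J_def)
  then obtain g where g: "{..<t} \<times> {..<s} \<times> {..<s} \<subseteq> g ` J"
    by (rule obtain_surj_on[rotated 2]) (auto simp: J_def)
  define pool where "pool P = (\<lambda>(l, x). e l (l \<in> P) x) ` ({..<t} \<times> {..<s})" for P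
  define edge where "edge = (\<lambda>(l, x, y). {e l True x, e l False y})"
  have pool: "finite (pool P)" "card (pool P) = t * s" for P
    unfolding pool_def
    by (simp, subst card_image) (auto simp: inj_on_def e_inj card_cartesian_product)
  \<comment> \<open>No range condition on \<open>p\<close>, so labels \<open>g j\<close> outside the
    index set also yield two-colour lists.\<close>
  have edge: "finite (edge p)" "card (edge p) = 2" for p
    by (auto simp: edge_def e_inj split: prod.splits)
  have "\<exists>S. finite S \<and> card S = f (Inl i) \<and> (i \<in> W \<longrightarrow> S \<subseteq> pool (\<pi> i))" for i
  proof (cases "i \<in> W")
    case True
    then show ?thesis
      using obtain_subset_with_card_n[of "f (Inl i)" "pool (\<pi> i)"] W(3) pool by metis
  next
    case False
    then show ?thesis by (intro exI[of _ "{..<f (Inl i)}"]) auto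
  qed
  then obtain LA where LA: "\<And>i. finite (LA i) \<and> card (LA i) = f (Inl i)"
    "\<And>i. i \<in> W \<Longrightarrow> LA i \<subseteq> pool (\<pi> i)" by metis
  have "\<exists>S. finite S \<and> card S = f (Inr j) \<and> (j \<in> J \<longrightarrow> S \<subseteq> edge (g j))" for j
  proof (cases "j \<in> J")
    case True
    then have "f (Inr j) \<le> card (edge (g j))" by (simp add: edge J_def)
    then show ?thesis
      using obtain_subset_with_card_n[of "f (Inr j)" "edge (g j)"] by metis
  next
    case False
    then show ?thesis by (intro exI[of _ "{..<f (Inr j)}"]) auto
  qed
  then obtain LB where LB: "\<And>j. finite (LB j) \<and> card (LB j) = f (Inr j)"
    "\<And>j. j \<in> J \<Longrightarrow> LB j \<subseteq> edge (g j)" by metis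
  obtain c where c: "\<And>i. i < a \<Longrightarrow> c (Inl i) \<in> LA i" "\<And>j. j < q \<Longrightarrow> c (Inr j) \<in> LB j"
    "\<And>i j. i < a \<Longrightarrow> j < q \<Longrightarrow> c (Inl i) \<noteq> c (Inr j)"
    by (rule choosable_complete_bipartiteD[OF f, of "case_sum LA LB"]) (auto simp: LA(1) LB(1))
  define S where "S = (\<lambda>i. c (Inl i)) ` {..<a}"
  have indep: "\<not> (e l True x \<in> S \<and> e l False y \<in> S)" if "l < t" "x < s" "y < s" for l x y
  proof
    assume S: "e l True x \<in> S \<and> e l False y \<in> S"
    have "(l, x, y) \<in> g ` J" using g that by auto
    then obtain j where j: "j \<in> J" "g j = (l, x, y)" by force
    then have "j < q" by (simp add: J_def)
    then have "c (Inr j) \<in> {e l True x, e l False y}"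
      using c(2)[of j] LB(2)[OF j(1)] j(2) by (auto simp: edge_def)
    then have "c (Inr j) \<in> S" using S by auto
    then show False using c(3)[OF _ \<open>j < q\<close>] unfolding S_def by force
  qed
  \<comment> \<open>The choice that avoids \<open>S\<close>: if the \<open>True\<close> half of copy
    \<open>l\<close> meets \<open>S\<close>, then \<open>indep\<close> keeps \<open>S\<close> off
    its \<open>False\<close> half, which is the one that \<open>P\<close> takes there.\<close>
  define P where "P = {l. l < t \<and> (\<forall>x<s. e l True x \<notin> S)}"
  have "P \<in> \<pi> ` W" using \<pi> unfolding bij_betw_def by (auto simp: P_def)
  then obtain i where i: "i \<in> W" "\<pi> i = P" by auto
  then have "i < a" using W(1) by auto
  then have "c (Inl i) \<in> pool P" using c(1)[of i] LA(2)[OF i(1)] i(2) by auto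
  then obtain l x where lx: "l < t" "x < s" "c (Inl i) = e l (l \<in> P) x"
    by (auto simp: pool_def)
  have "e l (l \<in> P) x \<in> S" using lx(3) \<open>i < a\<close> unfolding S_def by force
  then show False
  proof (cases "l \<in> P")
    case True
    then show False using \<open>e l (l \<in> P) x \<in> S\<close> lx(2) by (auto simp: P_def)
  next
    case False
    then obtain y where "y < s" "e l True y \<in> S" using lx(1) by (auto simp: P_def)
    then show False using indep[OF lx(1) _ lx(2)] \<open>e l (l \<in> P) x \<in> S\<close> False by auto
  qed
qed

text \<open>For \<open>L = ln a\<close>, \<open>Q = q\<close>, the side length is the least
  \<open>s\<close> with \<open>t * s \<ge> D\<close>, and the cube must fit into the
  \<open>q\<close>-vertices with lists of size at most 2. Rounding up costs
  \<open>t * s\<^sup>2 \<le> D\<^sup>2 / t + 2 * D + t\<close>. The first term is controlled by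
  \<open>L \<le> 3 * t\<close>, the others by \<open>sqrt (Q * L) \<le> Q / 4\<close> and
  \<open>t \<le> Q / 4\<close>.\<close>

lemma sum_choice_bound_cube_size:
  fixes L Q :: real and a t :: nat
  assumes "a \<ge> 2" "1 \<le> t" "t \<le> a" "L \<le> 3 * real t" "1/2 \<le> L" "4 * (real a)\<^sup>2 * L < Q"
  defines "D \<equiv> 0.12 * sqrt (Q * L)"
  shows "real (t * (nat \<lceil>D / t\<rceil>)\<^sup>2) \<le> 0.97 * Q"
proof -
  define r where "r = sqrt (Q * L)"
  have a2: "real a * 2 \<le> (real a)\<^sup>2"
    using assms(1) by (simp add: power2_eq_square mult_left_mono)
  have "(real a)\<^sup>2 * (1/2) \<le> (real a)\<^sup>2 * L" using assms(5) by (intro mult_left_mono) auto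
  then have t_le: "real t \<le> Q / 4" using a2 assms(3,6) by linarith
  then have Q: "Q > 0" using assms(2) by linarith
  have "4 \<le> (real a)\<^sup>2" using a2 assms(1) by linarith
  then have "4 * L \<le> (real a)\<^sup>2 * L" using assms(5) by (intro mult_right_mono) auto
  then have "L \<le> Q / 16" using assms(6) by linarith
  then have "Q * L \<le> Q * (Q / 16)" using Q by (intro mult_left_mono) auto
  also have "\<dots> = (Q / 4)\<^sup>2" by (simp add: power2_eq_square)
  finally have "r \<le> Q / 4" unfolding r_def using Q by (intro real_le_lsqrt) auto
  moreover have "r \<ge> 0" unfolding r_def using Q assms(5) by simp
  ultimately have r: "r \<le> Q / 4" "r \<ge> 0" .
  have r2: "r\<^sup>2 = Q * L" unfolding r_def using Q assms(5) by simp
  have t: "real t > 0" using assms(2) by simp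
  have D: "D = 0.12 * r" by (simp add: D_def r_def)
  have "D / t \<ge> 0" using r D t by simp
  then have "real (nat \<lceil>D / t\<rceil>) \<le> D / t + 1" by linarith
  then have "(real (nat \<lceil>D / t\<rceil>))\<^sup>2 \<le> (D / t + 1)\<^sup>2" by (intro power_mono) auto
  then have "real t * (real (nat \<lceil>D / t\<rceil>))\<^sup>2 \<le> real t * (D / t + 1)\<^sup>2"
    using t by (intro mult_left_mono) auto
  also have "\<dots> = D\<^sup>2 / t + 2 * D + t"
    using t by (simp add: field_simps power2_eq_square)
  also have "D\<^sup>2 = 0.0144 * (Q * L)" using r2 by (simp add: D power_mult_distrib power2_eq_square)
  also have "0.0144 * (Q * L) / t \<le> 0.0144 * (Q * (3 * t)) / t"
    using assms(4) Q t by (intro divide_right_mono mult_left_mono) auto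
  also have "\<dots> \<le> Q / 20" using t Q by simp
  finally have "real t * (real (nat \<lceil>D / t\<rceil>))\<^sup>2 \<le> Q / 20 + 2 * D + t"
    by linarith
  also have "D \<le> 3 / 100 * Q" using r D by simp
  finally have "real (t * (nat \<lceil>D / t\<rceil>)\<^sup>2) \<le> 9 / 10 * Q"
    using t_le Q unfolding of_nat_mult of_nat_power by linarith
  also have "\<dots> \<le> 0.97 * Q" using Q by simp
  finally show ?thesis .
qed

lemma obtain_cube_dimension:
  fixes a :: nat
  assumes "a \<ge> 2"
  obtains t where "1 \<le> t" "t \<le> a" "2 ^ t \<le> a div 2 + 1" "ln (real a) \<le> 3 * real t"
proof -
  \<comment> \<open>The largest possible \<open>t\<close>; maximality gives
    \<open>ln a \<le> t + 2\<close>, and \<open>t \<ge> 1\<close> turns this into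
    \<open>3 * t\<close>.\<close>
  obtain t where t: "2 ^ t \<le> a div 2 + 1" "a div 2 + 1 < 2 ^ (t + 1)"
    using ex_power_ivl1[of 2 "a div 2 + 1"] by auto
  have t1: "t \<ge> 1" using t(2) assms by (cases t) auto
  have "a < 2 ^ (t + 2)" using t(2) by simp
  then have "real a \<le> 2 ^ (t + 2)"
    by (metis less_imp_le of_nat_le_iff of_nat_numeral of_nat_power)
  then have "ln (real a) \<le> ln (2 ^ (t + 2))" using assms by (subst ln_le_cancel_iff) auto
  also have "\<dots> = real (t + 2) * ln 2" by (simp only: ln_realpow)
  also have "\<dots> \<le> real (t + 2) * 1" using ln_le_minus_one[of 2] by (intro mult_left_mono) auto
  finally have "ln (real a) \<le> 3 * real t" using t1 by simp
  moreover have "t < 2 ^ t" by simp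
  then have "t \<le> a" using t(1) assms by linarith
  ultimately show thesis using that t1 t(1) by blast
qed

lemma ln_2_ge_half: "ln (2::real) \<ge> 1/2"
  using ln_le_minus_one[of "1/2"] by (simp add: ln_div)

lemma choosable_complete_bipartite_sum_ge:
  assumes a: "a \<ge> 2" and q: "real q > 4 * (real a)\<^sup>2 * ln (real a)"
    and f: "choosable (complete_bipartite a q) f"
  shows "2 * real q + 0.06 * real a * sqrt (real q * ln (real a))
    \<le> real (\<Sum>v \<in> fst (complete_bipartite a q). f v)"
proof (rule ccontr)
  assume neg: "\<not> ?thesis"
  define r where "r = sqrt (real q * ln (real a))"
  define T where "T = 0.06 * real a * r"
  define F where "F = (\<Sum>i<a. f (Inl i))"
  define q1 where "q1 = card {j. j < q \<and> f (Inr j) = 1}"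
  define q3 where "q3 = card {j. j < q \<and> f (Inr j) > 2}"
  define J where "J = {j. j < q \<and> f (Inr j) \<le> 2}"
  have L: "ln (real a) \<ge> 1/2"
    using ln_2_ge_half a by (intro order_trans[OF ln_2_ge_half]) simp
  have "4 * (real a)\<^sup>2 * ln (real a) \<ge> 0" using L by simp
  then have qpos: "real q > 0" using q by linarith
  have rpos: "r > 0" unfolding r_def using qpos L by simp

  have "(\<Sum>v \<in> fst (complete_bipartite a q). f v) = F + (\<Sum>j<q. f (Inr j))"
    by (simp add: complete_bipartite_def F_def sum.Plus)
  then have total: "real F + (\<Sum>j<q. real (f (Inr j))) < 2 * real q + T"
    using neg by (simp add: T_def r_def)
  \<comment> \<open>Relative to 2 per vertex, a list of size 1 saves one and a list of size above 2
    costs at least one; positivity of \<open>f\<close> excludes larger savings.\<close>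
  have "(\<Sum>j<q. 2 - of_bool (f (Inr j) = 1) + of_bool (f (Inr j) > 2)) \<le> (\<Sum>j<q. real (f (Inr j)))"
    using choosable_complete_bipartite_pos[OF f] by (intro sum_mono) (fastforce simp: of_bool_def)
  moreover have "(\<Sum>j<q. of_bool (f (Inr j) = 1)) = real q1"
    "(\<Sum>j<q. of_bool (f (Inr j) > 2)) = real q3"
    by (simp_all add: q1_def q3_def sum_of_bool_eq Int_def)
  ultimately have F: "real F - q1 + q3 < T"
    using total by (simp add: sum.distrib sum_subtractf)
  have q1: "q1 < f (Inl i)" if "i < a" for i
    using choosable_complete_bipartite_singletons_less[OF f that] by (simp add: q1_def)

  obtain t where t: "1 \<le> t" "t \<le> a" "2 ^ t \<le> a div 2 + 1" "ln (real a) \<le> 3 * real t"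
    using obtain_cube_dimension[OF a] .
  \<comment> \<open>\<open>D = 2 * T / a\<close>, so \<open>a / 2\<close> lists longer than
    \<open>D\<close> already use up the excess \<open>T\<close>.\<close>
  define D where "D = 0.12 * r"
  define s where "s = nat \<lceil>D / t\<rceil>"
  define W where "W = {i. i < a \<and> real (f (Inl i)) \<le> D}"
  have W_le: "f (Inl i) \<le> t * s" if "i \<in> W" for i
  proof -
    have "real t * (D / t) \<le> real t * s" unfolding s_def by (intro mult_left_mono) linarith+
    then have "D \<le> real (t * s)" using t(1) by simp
    then have "real (f (Inl i)) \<le> real (t * s)" using that unfolding W_def by simp
    then show ?thesis by (simp only: of_nat_le_iff)
  qed
  have "2 ^ t \<le> card W"
  proof (rule ccontr)
    assume less: "\<not> ?thesis"
    \<comment> \<open>The list of \<open>i0\<close> is reserved to outweigh the saving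
      \<open>q1\<close>. Taking \<open>i0\<close> from \<open>W\<close> when possible leaves all
      long lists in \<open>C\<close>; if \<open>W\<close> is empty, removing one vertex still leaves
      \<open>a / 2\<close>, as \<open>a \<ge> 2\<close>.\<close>
    obtain i0 where i0: "i0 < a" "W \<noteq> {} \<longrightarrow> i0 \<in> W"
    proof (cases "W = {}")
      case True
      then show ?thesis using that[of 0] a by simp
    next
      case False
      then show ?thesis using that by (auto simp: W_def)
    qed
    define C where "C = {..<a} - insert i0 W"
    have "card (insert i0 W) \<le> a div 2"
    proof (cases "W = {}")
      case False
      then have "insert i0 W = W" using i0 by auto
      moreover have "card W < a div 2 + 1" using less t(3) by linarith
      ultimately show ?thesis by simp
    qed (use a in auto)
    moreover have "card C = a - card (insert i0 W)"
      unfolding C_def using i0 by (subst card_Diff_subset) (auto simp: W_def)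
    ultimately have C: "real a / 2 \<le> card C" by linarith
    have "T = real a / 2 * D" by (simp add: T_def D_def)
    also have "\<dots> \<le> card C * D" using C rpos by (intro mult_right_mono) (auto simp: D_def)
    also have "\<dots> = (\<Sum>i\<in>C. D)" by simp
    also have "\<dots> \<le> (\<Sum>i\<in>C. real (f (Inl i)))"
      by (intro sum_mono) (auto simp: C_def W_def)
    finally have "T \<le> (\<Sum>i\<in>C. real (f (Inl i)))" .
    moreover have "(\<Sum>i\<in>insert i0 C. f (Inl i)) \<le> F"
      unfolding F_def using i0 by (intro sum_mono2) (auto simp: C_def)
    then have "real (f (Inl i0) + (\<Sum>i\<in>C. f (Inl i))) \<le> real F"
      by (subst of_nat_le_iff) (simp add: C_def)
    ultimately show False using F q1[OF i0(1)] by simp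
  qed
  then obtain W' where W': "W' \<subseteq> W" "card W' = 2 ^ t"
    using obtain_subset_with_card_n by metis

  \<comment> \<open>A single list on the \<open>a\<close>-side exceeds \<open>q1\<close>, so
    \<open>F - q1\<close> is positive and \<open>q3\<close> alone stays below
    \<open>T\<close>.\<close>
  have "f (Inl 0) \<le> F"
    unfolding F_def using a member_le_sum[of 0 "{..<a}" "\<lambda>i. f (Inl i)"] by simp
  then have "q3 < T" using F q1[of 0] a by linarith
  also have "T \<le> 0.03 * real q"
  proof -
    \<comment> \<open>The lower bound on \<open>q\<close> enters here: it gives
      \<open>a * r \<le> q / 2\<close>, hence \<open>T \<le> 0.03 * q\<close>, which leaves the
      share 0.97 of the \<open>q\<close>-side for the cube.\<close>
    have "(real a * r)\<^sup>2 = real q * ((real a)\<^sup>2 * ln (real a))"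
      using L qpos by (simp add: r_def power_mult_distrib)
    also have "\<dots> \<le> real q * (real q / 4)" using q qpos by (intro mult_left_mono) auto
    also have "\<dots> = (real q / 2)\<^sup>2" by (simp add: power2_eq_square)
    finally have "real a * r \<le> real q / 2" using qpos by (simp add: power2_le_iff_abs_le abs_le_iff)
    then show ?thesis by (simp add: T_def mult_ac)
  qed
  finally have q3: "q3 < 0.03 * real q" .
  have "card (J \<union> {j. j < q \<and> f (Inr j) > 2}) = card J + q3"
    unfolding q3_def J_def by (intro card_Un_disjoint) auto
  moreover have "J \<union> {j. j < q \<and> f (Inr j) > 2} = {..<q}" by (auto simp: J_def)
  ultimately have "real q = card J + q3" by simp
  then have "0.97 * real q \<le> card J" using q3 by simp
  moreover have "real (t * s\<^sup>2) \<le> 0.97 * real q"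
    using sum_choice_bound_cube_size[OF a t(1,2,4) L q] by (simp only: s_def D_def r_def)
  ultimately have "t * s\<^sup>2 \<le> card J" by linarith
  moreover have "W' \<subseteq> {..<a}" using W' by (auto simp: W_def)
  ultimately show False
    using not_choosable_complete_bipartite_cube[of W' a t f s q] W' W_le f unfolding J_def by blast
qed

theorem theorem4p2:
  fixes a q :: nat
  assumes "a \<ge> 2" and "real q > 4 * (real a)\<^sup>2 * ln (real a)"
  shows "real (sum_choice_number (complete_bipartite a q))
           \<ge> 2 * real q + 0.06 * real a * sqrt (real q * ln (real a))"
  using sum_choice_number_attained[OF complete_bipartite_finite_loopless]
    choosable_complete_bipartite_sum_ge[OF assms] by metis

end
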